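(* Let $n \ge 1$ and let $G = \prod_{i=1}^n G_i$ be a (non-trivial) direct product of finitely many pairwise non-commensurable hereditarily just infinite profinite groups $G_1, \ldots, G_n$, each of finite lower rank. Then $G$ has lower rank \[ \mathrm{lr}(G) = \max\{\mathrm{lr}(G_i) \mid 1 \le i \le n\}. \]
   Context: A profinite group $G$ is just infinite if $G$ is infinite and every non-trivial closed normal subgroup of $G$ is open in $G$. It is hereditarily just infinite if every open subgroup of $G$ is just infinite. Two profinite groups are commensurable if they have open subgroups that are isomorphic to each other (as profinite groups); "pairwise non-commensurable" means that $G_i$ and $G_j$ are not commensurable for $i \neq j$. For a profinite group $H$, $\mathrm{d}(H)$ denotes the minimal number of topological generators of $H$ (with value $\infty$ if $H$ is not topologically finitely generated). The lower rank of a profinite group $G$ is \[ \mathrm{lr}(G) = \liminf\{ \mathrm{d}(H) \mid H \text{ an open subgroup of } G\} \in \mathbb{N}_0 \cup \{\infty\}, \] the limit inferior being taken over the net of open subgroups of $G$ ordered by reverse inclusion, that is, $\mathrm{lr}(G) = \sup_{U} \inf\{\mathrm{d}(H) \mid H \le U,\ H \text{ open in } G\}$, with $U$ ranging over the open subgroups of $G$. Equivalently, for countably based $G$, $\mathrm{lr}(G) \le k$ if and only if there is a descending chain of $k$-generated open subgroups of $G$ that form a neighbourhood base for the identity. *)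

theory Defs
  imports
    "HOL-Analysis.Analysis"
    "HOL-Algebra.Generated_Groups"
    "HOL-Algebra.Product_Groups"
    "HOL-Library.Extended_Nat"
begin

text \<open>A topological group is given by a group \<open>G\<close> together with a topology \<open>T\<close> on its carrier; an open
  subgroup \<open>H\<close> is itself regarded as the topological group
  \<open>G\<lparr>carrier := H\<rparr>\<close>, \<open>subtopology T H\<close>.\<close>

locale topological_group = group G for G (structure) and T :: "'a topology" +
  assumes topspace_eq: "topspace T = carrier G"
    and continuous_mult: "continuous_map (prod_topology T T) T (\<lambda>(x, y). x \<otimes> y)"
    and continuous_inv: "continuous_map T T (\<lambda>x. inv x)"

locale profinite_group = topological_group +
  assumes compact: "compact_space T"
    and Hausdorff: "Hausdorff_space T"
    and totally_disconnected: "\<And>x. x \<in> topspace T \<Longrightarrow> connected_component_of_set T x = {x}"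

definition open_subgroup :: "'a set \<Rightarrow> ('a, 'b) monoid_scheme \<Rightarrow> 'a topology \<Rightarrow> bool" where
  "open_subgroup H G T \<longleftrightarrow> subgroup H G \<and> openin T H"

definition just_infinite :: "('a, 'b) monoid_scheme \<Rightarrow> 'a topology \<Rightarrow> bool" where
  "just_infinite G T \<longleftrightarrow> profinite_group G T \<and> infinite (carrier G) \<and>
     (\<forall>N. N \<lhd> G \<and> closedin T N \<and> N \<noteq> {\<one>\<^bsub>G\<^esub>} \<longrightarrow> openin T N)"

definition hereditarily_just_infinite :: "('a, 'b) monoid_scheme \<Rightarrow> 'a topology \<Rightarrow> bool" where
  "hereditarily_just_infinite G T \<longleftrightarrow> profinite_group G T \<and>
     (\<forall>H. open_subgroup H G T \<longrightarrow> just_infinite (G\<lparr>carrier := H\<rparr>) (subtopology T H))"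

definition commensurable ::
  "('a, 'b) monoid_scheme \<Rightarrow> 'a topology \<Rightarrow> ('c, 'd) monoid_scheme \<Rightarrow> 'c topology \<Rightarrow> bool" where
  "commensurable G T G' T' \<longleftrightarrow>
     (\<exists>H K f. open_subgroup H G T \<and> open_subgroup K G' T' \<and>
        f \<in> iso (G\<lparr>carrier := H\<rparr>) (G'\<lparr>carrier := K\<rparr>) \<and>
        homeomorphic_map (subtopology T H) (subtopology T' K) f)"

text \<open>The minimal number of topological generators; it is \<open>\<infinity>\<close> (the infimum of the
  empty set) if there is no finite topological generating set.\<close>

definition min_generators :: "('a, 'b) monoid_scheme \<Rightarrow> 'a topology \<Rightarrow> enat" where
  "min_generators G T =
     Inf {enat (card X) | X. finite X \<and> X \<subseteq> carrier G \<and> T closure_of (generate G X) = carrier G}"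

definition lower_rank :: "('a, 'b) monoid_scheme \<Rightarrow> 'a topology \<Rightarrow> enat" where
  "lower_rank G T =
     (SUP U \<in> {U. open_subgroup U G T}.
        INF H \<in> {H. open_subgroup H G T \<and> H \<subseteq> U}.
          min_generators (G\<lparr>carrier := H\<rparr>) (subtopology T H))"

end

theory Submission
  imports Defs
begin

text \<open>
  The lower bound holds because projections carry generating sets of open subgroups to generating
  sets of open subgroups. For the upper bound, let \<open>d\<close> be the maximum, choose small \<open>d\<close>-generated
  open \<open>H\<^sub>i \<le> G\<^sub>i\<close> and combine their generators coordinatewise into \<open>d\<close> elements of the
  product, which topologically generate a closed subgroup \<open>H\<close> projecting onto every \<open>H\<^sub>i\<close>.
  It remains to see that such an \<open>H\<close> is open.

  For a set \<open>J\<close> of indices let \<open>H\<^sub>J\<close> be the subgroup of those elements of \<open>H\<close> supported on \<open>J\<close>.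
  Its projection to \<open>G\<^sub>k\<close> is closed and normal in the projection of \<open>H\<close>, hence trivial or
  open. Take \<open>J\<close> minimal such that \<open>H\<^sub>J\<close> projects non-trivially to \<open>G\<^sub>i\<close>, and
  suppose that \<open>J\<close> contains some \<open>j \<noteq> i\<close>. By minimality the kernel of the projection
  \<open>\<pi>\<^sub>j\<close> on \<open>H\<^sub>J\<close> lies in that of \<open>\<pi>\<^sub>i\<close>. If \<open>\<pi>\<^sub>j\<close> is trivial on the kernel of \<open>\<pi>\<^sub>i\<close>, the
  kernels agree and \<open>G\<^sub>i\<close>, \<open>G\<^sub>j\<close> are commensurable; otherwise the kernel of \<open>\<pi>\<^sub>i\<close> is open in
  \<open>H\<^sub>J\<close>, so \<open>\<pi>\<^sub>i(H\<^sub>J)\<close> is finite and open in the infinite group \<open>G\<^sub>i\<close>. Both are impossible, so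
  \<open>J = {i}\<close>: thus \<open>H\<close> meets each factor in an open subgroup.
\<close>

section \<open>Topological groups\<close>

lemma Inf_enat_in: "A \<noteq> {} \<Longrightarrow> Inf A \<in> A" for A :: "enat set"
  using wellorder_InfI by blast

context topological_group
begin

lemma continuous_map_group_mult:
  assumes "continuous_map X T f" "continuous_map X T g"
  shows "continuous_map X T (\<lambda>x. f x \<otimes> g x)"
proof -
  have "continuous_map X (prod_topology T T) (\<lambda>x. (f x, g x))"
    using assms by (simp add: continuous_map_pairedI)
  from continuous_map_compose[OF this continuous_mult] show ?thesis
    by (simp add: o_def)
qed

lemma openin_translate:
  assumes "openin T V" "a \<in> carrier G"
  shows "openin T {x \<in> carrier G. a \<otimes> x \<in> V}"
proof -
  have "continuous_map T T (\<lambda>x. a \<otimes> x)"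
    by (intro continuous_map_group_mult) (auto simp: assms topspace_eq)
  from openin_continuous_map_preimage[OF this assms(1)] show ?thesis
    by (simp add: topspace_eq)
qed

text \<open>Left translation by \<open>v \<otimes> inv h\<close>, with \<open>v\<close> in
  \<open>V\<close>, sends \<open>h\<close> to \<open>v\<close>. The preimage of \<open>V\<close>
  under it is an open neighbourhood of \<open>h\<close>, and it stays inside \<open>H\<close>
  because the translating element lies in \<open>H\<close>.\<close>

lemma openin_subgroupI:
  assumes H: "subgroup H G" and V: "openin T V" "V \<subseteq> H" "V \<noteq> {}"
  shows "openin T H"
proof (subst openin_subopen, intro ballI)
  interpret H: subgroup H G by fact
  fix h assume h: "h \<in> H"
  obtain v where v: "v \<in> V" using V by auto
  then have v': "v \<in> H" using V by auto
  let ?a = "v \<otimes> inv h"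
  have a: "?a \<in> H" using h v' by simp
  have "x \<in> H" if "x \<in> carrier G" "?a \<otimes> x \<in> V" for x
  proof -
    have "inv ?a \<otimes> (?a \<otimes> x) \<in> H"
      using a that V by auto
    moreover have "inv ?a \<otimes> (?a \<otimes> x) = x"
      using a that by (simp add: m_assoc[symmetric])
    ultimately show ?thesis by simp
  qed
  moreover have "?a \<otimes> h = v"
    using h v' by (simp add: m_assoc)
  ultimately have "h \<in> {x \<in> carrier G. ?a \<otimes> x \<in> V}" "{x \<in> carrier G. ?a \<otimes> x \<in> V} \<subseteq> H"
    using h v by auto
  then show "\<exists>W. openin T W \<and> h \<in> W \<and> W \<subseteq> H"
    using openin_translate[OF V(1) H.mem_carrier[OF a]] by blast
qed

text \<open>The complement is a union of left cosets of \<open>H\<close>, each of them open as a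
  translate of \<open>H\<close>.\<close>

lemma closedin_open_subgroup:
  assumes H: "subgroup H G" "openin T H"
  shows "closedin T H"
proof -
  interpret H: subgroup H G by fact
  have "openin T (carrier G - H)"
  proof (subst openin_subopen, intro ballI)
    fix x assume x: "x \<in> carrier G - H"
    have "y \<notin> H" if "y \<in> carrier G" "inv x \<otimes> y \<in> H" for y
    proof
      assume "y \<in> H"
      then have "y \<otimes> inv (inv x \<otimes> y) \<in> H" using that by simp
      moreover have "y \<otimes> inv (inv x \<otimes> y) = x"
        using that x by (simp add: inv_mult_group m_assoc[symmetric])
      ultimately show False using x by simp
    qed
    then have "{y \<in> carrier G. inv x \<otimes> y \<in> H} \<subseteq> carrier G - H"
      by blast
    moreover have "x \<in> {y \<in> carrier G. inv x \<otimes> y \<in> H}"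
      using x by simp
    moreover have "openin T {y \<in> carrier G. inv x \<otimes> y \<in> H}"
      using x by (intro openin_translate[OF H(2)]) simp
    ultimately show "\<exists>W. openin T W \<and> x \<in> W \<and> W \<subseteq> carrier G - H"
      by blast
  qed
  then show ?thesis
    by (simp add: closedin_def topspace_eq H.subset)
qed

text \<open>Continuous maps send closures into closures, and the closure of
  \<open>H \<times> H\<close> is the product of the closures.\<close>

lemma subgroup_closure:
  assumes H: "subgroup H G"
  shows "subgroup (T closure_of H) G"
proof -
  interpret H: subgroup H G by fact
  show ?thesis
  proof (rule subgroupI)
    show "T closure_of H \<subseteq> carrier G"
      using closure_of_subset_topspace topspace_eq by metis
    have HS: "H \<subseteq> T closure_of H"
      by (simp add: H.subset closure_of_subset topspace_eq)
    then show "T closure_of H \<noteq> {}" using H.one_closed by blast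
    fix x assume x: "x \<in> T closure_of H"
    have "(\<lambda>x. inv x) ` (T closure_of H) \<subseteq> T closure_of ((\<lambda>x. inv x) ` H)"
      by (rule continuous_map_image_closure_subset[OF continuous_inv])
    also have "\<dots> \<subseteq> T closure_of H"
      by (rule closure_of_mono) auto
    finally show "inv x \<in> T closure_of H" using x by auto
    fix y assume y: "y \<in> T closure_of H"
    have "(\<lambda>(x, y). x \<otimes> y) ` (prod_topology T T closure_of (H \<times> H))
        \<subseteq> T closure_of ((\<lambda>(x, y). x \<otimes> y) ` (H \<times> H))"
      by (rule continuous_map_image_closure_subset[OF continuous_mult])
    also have "\<dots> \<subseteq> T closure_of H"
      by (rule closure_of_mono) auto
    finally show "x \<otimes> y \<in> T closure_of H"
      using x y by (force simp: closure_of_Times)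
  qed
qed

section \<open>Topological generators of subgroups and of their images\<close>

lemma min_generators_subgroup:
  assumes "subgroup H G"
  shows "min_generators (G\<lparr>carrier := H\<rparr>) (subtopology T H) =
    Inf {enat (card X) | X. finite X \<and> X \<subseteq> H \<and> H \<subseteq> T closure_of (generate G X)}"
proof -
  \<comment> \<open>The generated subgroup lies in \<open>H\<close>, so its closure in the subspace
    is its closure in \<open>T\<close> cut down to \<open>H\<close>.\<close>
  have "(subtopology T H closure_of generate (G\<lparr>carrier := H\<rparr>) X = H) \<longleftrightarrow>
      H \<subseteq> T closure_of (generate G X)" if "X \<subseteq> H" for X
    using generate_subgroup_incl[OF that assms] generate_consistent[OF that assms]
    by (auto simp: closure_of_subtopology Int_absorb1)
  then show ?thesis
    unfolding min_generators_def by (intro arg_cong[where f = Inf]) auto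
qed

lemma min_generators_subgroup_le:
  assumes "subgroup H G" "finite X" "X \<subseteq> H" "H \<subseteq> T closure_of (generate G X)"
  shows "min_generators (G\<lparr>carrier := H\<rparr>) (subtopology T H) \<le> enat (card X)"
  unfolding min_generators_subgroup[OF assms(1)] using assms by (intro Inf_lower) auto

lemma min_generators_subgroup_attained:
  assumes "subgroup H G" "min_generators (G\<lparr>carrier := H\<rparr>) (subtopology T H) < \<infinity>"
  obtains X where "finite X" "X \<subseteq> H" "H \<subseteq> T closure_of (generate G X)"
    "min_generators (G\<lparr>carrier := H\<rparr>) (subtopology T H) = enat (card X)"
proof -
  let ?S = "{enat (card X) | X. finite X \<and> X \<subseteq> H \<and> H \<subseteq> T closure_of (generate G X)}"
  \<comment> \<open>An empty set would have infimum \<open>\<infinity>\<close>. Once the set is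
    non-empty, well-ordering makes the infimum a member.\<close>
  have "?S \<noteq> {}"
    using assms unfolding min_generators_subgroup[OF assms(1)] by (force simp: Inf_enat_def)
  then have "Inf ?S \<in> ?S"
    by (rule Inf_enat_in)
  then show thesis
    using that assms(1) by (auto simp: min_generators_subgroup)
qed

text \<open>A continuous homomorphism maps a topological generating set of \<open>H\<close> to one
  of the image, and a finite set does not grow under a map. An infinite right-hand side leaves
  nothing to prove.\<close>

lemma min_generators_image_le:
  assumes "topological_group K S" and hom: "p \<in> hom G K" and cont: "continuous_map T S p"
    and H: "subgroup H G"
  shows "min_generators (K\<lparr>carrier := p ` H\<rparr>) (subtopology S (p ` H))
    \<le> min_generators (G\<lparr>carrier := H\<rparr>) (subtopology T H)" (is "?l \<le> ?r")
proof (cases "?r < \<infinity>")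
  case True
  interpret K: topological_group K S by fact
  interpret p: group_hom G K p
    using hom by unfold_locales
  obtain X where X: "finite X" "X \<subseteq> H" "H \<subseteq> T closure_of (generate G X)" "?r = enat (card X)"
    using min_generators_subgroup_attained[OF H True] by auto
  have "X \<subseteq> carrier G" using X(2) subgroup.subset[OF H] by auto
  have "p ` H \<subseteq> p ` (T closure_of (generate G X))" using X(3) by auto
  also have "\<dots> \<subseteq> S closure_of (p ` generate G X)"
    by (rule continuous_map_image_closure_subset[OF cont])
  also have "p ` generate G X = generate K (p ` X)"
    using p.generate_img[OF \<open>X \<subseteq> carrier G\<close>] by simp
  finally have "?l \<le> enat (card (p ` X))"
    using X p.subgroup_img_is_subgroup[OF H] by (intro K.min_generators_subgroup_le) auto
  also have "\<dots> \<le> ?r"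
    using X by (simp add: card_image_le)
  finally show ?thesis .
qed simp

end

section \<open>Direct products of topological groups\<close>

lemma topological_group_product:
  assumes "\<And>i. i \<in> I \<Longrightarrow> topological_group (G i) (T i)"
  shows "topological_group (product_group I G) (product_topology T I)"
proof -
  let ?P = "product_group I G" and ?S = "product_topology T I"
  have grp: "group (G i)" if "i \<in> I" for i
    using assms[OF that] by (simp add: topological_group_def)
  interpret P: group ?P by (rule product_group) (rule grp)
  have top: "topspace (T i) = carrier (G i)" if "i \<in> I" for i
    using topological_group.topspace_eq[OF assms[OF that]] .
  show ?thesis
  proof
    show tP: "topspace ?S = carrier ?P"
      by (auto simp: top intro!: PiE_cong)
    show "continuous_map (prod_topology ?S ?S) ?S (\<lambda>(x, y). x \<otimes>\<^bsub>?P\<^esub> y)"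
    proof (subst continuous_map_componentwise, intro conjI ballI)
      show "(\<lambda>(x, y). x \<otimes>\<^bsub>?P\<^esub> y) ` topspace (prod_topology ?S ?S) \<subseteq> extensional I"
        by auto
      fix k assume k: "k \<in> I"
      have "continuous_map (prod_topology ?S ?S) (T k) (\<lambda>z. fst z k)"
        using continuous_map_compose[OF continuous_map_fst continuous_map_product_projection[OF k]]
        by (simp add: o_def)
      moreover have "continuous_map (prod_topology ?S ?S) (T k) (\<lambda>z. snd z k)"
        using continuous_map_compose[OF continuous_map_snd continuous_map_product_projection[OF k]]
        by (simp add: o_def)
      ultimately show "continuous_map (prod_topology ?S ?S) (T k) (\<lambda>z. (case z of (x, y) \<Rightarrow> x \<otimes>\<^bsub>?P\<^esub> y) k)"
        using topological_group.continuous_map_group_mult[OF assms[OF k]] k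
        by (simp add: case_prod_beta)
    qed
    \<comment> \<open>Continuity is checked for the coordinatewise formula and then transferred to
      \<open>inv\<close>, which agrees with it on the carrier.\<close>
    have "continuous_map ?S ?S (\<lambda>x. \<lambda>i\<in>I. inv\<^bsub>G i\<^esub> x i)"
    proof (subst continuous_map_componentwise, intro conjI ballI)
      show "(\<lambda>x. \<lambda>i\<in>I. inv\<^bsub>G i\<^esub> x i) ` topspace ?S \<subseteq> extensional I"
        by auto
      fix k assume k: "k \<in> I"
      then show "continuous_map ?S (T k) (\<lambda>x. (\<lambda>i\<in>I. inv\<^bsub>G i\<^esub> x i) k)"
        using continuous_map_compose[OF continuous_map_product_projection[OF k, of T]
          topological_group.continuous_inv[OF assms[OF k]]]
        by (simp add: o_def)
    qed
    then show "continuous_map ?S ?S (\<lambda>x. inv\<^bsub>?P\<^esub> x)"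
      by (rule continuous_map_eq) (simp add: tP grp del: topspace_product_topology)
  qed
qed

lemma product_projection_hom: "i \<in> I \<Longrightarrow> (\<lambda>x. x i) \<in> hom (product_group I G) (G i)"
  by (auto simp: hom_def)

lemma product_embedding_hom:
  assumes "i \<in> I" "\<And>k. k \<in> I \<Longrightarrow> group (G k)"
  shows "(\<lambda>x. \<lambda>k\<in>I. if k = i then x else \<one>\<^bsub>G k\<^esub>) \<in> hom (G i) (product_group I G)"
  using assms by (auto simp: hom_def group.is_monoid intro!: restrict_ext)

lemma product_embedding_continuous:
  assumes "i \<in> I" "\<And>k. k \<in> I \<Longrightarrow> topological_group (G k) (T k)"
  shows "continuous_map (T i) (product_topology T I) (\<lambda>x. \<lambda>k\<in>I. if k = i then x else \<one>\<^bsub>G k\<^esub>)"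
proof (subst continuous_map_componentwise, intro conjI ballI)
  fix k assume k: "k \<in> I"
  interpret topological_group "G k" "T k" using assms k by auto
  show "continuous_map (T i) (T k) (\<lambda>x. (\<lambda>k\<in>I. if k = i then x else \<one>\<^bsub>G k\<^esub>) k)"
    using k by (cases "k = i") (auto simp: topspace_eq)
qed auto

text \<open>A family over a finite index set is the product of its coordinates embedded one at a
  time. The induction enlarges the set \<open>F\<close> of coordinates already restored, all others
  being the identity.\<close>

lemma PiE_subset_subgroup:
  assumes I: "finite I" and grp: "\<And>k. k \<in> I \<Longrightarrow> group (G k)"
    and H: "subgroup H (product_group I G)"
    and N: "\<And>k x. k \<in> I \<Longrightarrow> x \<in> N k \<Longrightarrow>
      x \<in> carrier (G k) \<and> (\<lambda>j\<in>I. if j = k then x else \<one>\<^bsub>G j\<^esub>) \<in> H"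
  shows "(\<Pi>\<^sub>E k\<in>I. N k) \<subseteq> H"
proof
  fix x assume x: "x \<in> (\<Pi>\<^sub>E k\<in>I. N k)"
  have "(\<lambda>j\<in>I. if j \<in> F then x j else \<one>\<^bsub>G j\<^esub>) \<in> H" if "finite F" "F \<subseteq> I" for F
    using that
  proof (induction F rule: finite_induct)
    case empty
    then show ?case using subgroup.one_closed[OF H] by (simp add: restrict_def)
  next
    case (insert k F)
    then have IH: "(\<lambda>j\<in>I. if j \<in> F then x j else \<one>\<^bsub>G j\<^esub>) \<in> H" by blast
    have "(\<lambda>j\<in>I. if j = k then x k else \<one>\<^bsub>G j\<^esub>) \<otimes>\<^bsub>product_group I G\<^esub>
        (\<lambda>j\<in>I. if j \<in> F then x j else \<one>\<^bsub>G j\<^esub>) \<in> H"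
      using insert.prems N[of k "x k"] x by (intro subgroup.m_closed[OF H] IH) (simp add: PiE_iff)
    also have "(\<lambda>j\<in>I. if j = k then x k else \<one>\<^bsub>G j\<^esub>) \<otimes>\<^bsub>product_group I G\<^esub>
        (\<lambda>j\<in>I. if j \<in> F then x j else \<one>\<^bsub>G j\<^esub>) = (\<lambda>j\<in>I. if j \<in> insert k F then x j else \<one>\<^bsub>G j\<^esub>)"
    proof -
      have "x k \<in> carrier (G k)" if "k \<in> I" for k
        using N x that by (simp add: PiE_iff)
      then show ?thesis
        using insert grp by (auto simp: group.is_monoid intro!: restrict_ext)
    qed
    finally show ?case .
  qed
  from this[OF I] have "(\<lambda>j\<in>I. x j) \<in> H" by (auto cong: restrict_cong)
  then show "x \<in> H" using x by simp
qed

section \<open>Subgroups with open projections\<close>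

context topological_group
begin

text \<open>The cosets of the kernel form an open cover of the compact \<open>L\<close>. Finitely
  many suffice, and \<open>p\<close> is constant on each.\<close>

lemma finite_image_open_kernel:
  assumes K: "group K" and p: "p \<in> hom G K"
    and L: "subgroup L G" "compactin T L"
    and ker: "openin (subtopology T L) {x \<in> L. p x = \<one>\<^bsub>K\<^esub>}"
  shows "finite (p ` L)"
proof -
  interpret p: group_hom G K p
    using K p is_group by (simp add: group_hom_def group_hom_axioms_def)
  interpret L: subgroup L G by fact
  obtain V where V: "openin T V" "{x \<in> L. p x = \<one>\<^bsub>K\<^esub>} = V \<inter> L"
    using ker by (auto simp: openin_subtopology)
  \<comment> \<open>\<open>W l\<close> meets \<open>L\<close> exactly in the coset of
    \<open>l\<close> modulo the kernel.\<close>
  define W where "W l = {x \<in> carrier G. inv l \<otimes> x \<in> V}" for l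
  have "openin T (W l)" if "l \<in> L" for l
    unfolding W_def using that by (intro openin_translate[OF V(1)]) auto
  moreover have "L \<subseteq> \<Union>(W ` L)"
  proof
    fix l assume l: "l \<in> L"
    have "\<one> \<in> {x \<in> L. p x = \<one>\<^bsub>K\<^esub>}" by simp
    then have "\<one> \<in> V" unfolding V(2) by blast
    then have "l \<in> W l" using l by (simp add: W_def)
    then show "l \<in> \<Union>(W ` L)" using l by blast
  qed
  ultimately obtain \<F> where \<F>: "finite \<F>" "\<F> \<subseteq> W ` L" "L \<subseteq> \<Union>\<F>"
    using compactinD[OF L(2), of "W ` L"] by auto
  then obtain F where F: "finite F" "F \<subseteq> L" "\<F> = W ` F"
    by (meson finite_subset_image)
  have "p x \<in> p ` F" if x: "x \<in> L" for x
  proof -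
    obtain l where l: "l \<in> F" "x \<in> W l" using \<F> F x by auto
    then have lL: "l \<in> L" using F by auto
    have "inv l \<otimes> x \<in> {x \<in> L. p x = \<one>\<^bsub>K\<^esub>}"
      using V(2) l lL x by (simp add: W_def)
    then have "inv\<^bsub>K\<^esub> (p l) \<otimes>\<^bsub>K\<^esub> p x = \<one>\<^bsub>K\<^esub>"
      using lL x by simp
    then have "p x = p l"
      using lL x p.H.inv_solve_left'[of "\<one>\<^bsub>K\<^esub>" "p l" "p x"] by simp
    then show ?thesis using l by auto
  qed
  then show ?thesis
    using F(1) by (meson finite_imageI finite_subset image_subsetI)
qed

text \<open>Both images are the quotient of \<open>L\<close> by the same kernel. Since
  \<open>L\<close> is compact and the targets are Hausdorff, \<open>p\<close> is a quotient map onto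
  its image, so \<open>q\<close> factors through it by a continuous bijection from a compact to a
  Hausdorff space, which is a homeomorphism.\<close>

lemma commensurable_images:
  assumes L: "subgroup L G" "compactin T L"
    and A: "group A" "Hausdorff_space TA" "p \<in> hom G A" "continuous_map T TA p" "openin TA (p ` L)"
    and B: "group B" "Hausdorff_space TB" "q \<in> hom G B" "continuous_map T TB q" "openin TB (q ` L)"
    and ker: "\<And>x. x \<in> L \<Longrightarrow> p x = \<one>\<^bsub>A\<^esub> \<longleftrightarrow> q x = \<one>\<^bsub>B\<^esub>"
  shows "commensurable A TA B TB"
proof -
  interpret p: group_hom G A p
    using A is_group by (simp add: group_hom_def group_hom_axioms_def)
  interpret q: group_hom G B q
    using B is_group by (simp add: group_hom_def group_hom_axioms_def)
  interpret L: subgroup L G by fact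
  \<comment> \<open>Left to right lets \<open>q\<close> factor through \<open>p\<close>; right to
    left makes the factor map injective.\<close>
  have eq_iff: "p x = p y \<longleftrightarrow> q x = q y" if "x \<in> L" "y \<in> L" for x y
  proof -
    have "p x = p y \<longleftrightarrow> p (inv y \<otimes> x) = \<one>\<^bsub>A\<^esub>"
      using that p.H.inv_solve_left'[of "\<one>\<^bsub>A\<^esub>" "p y" "p x"] by auto
    also have "\<dots> \<longleftrightarrow> q (inv y \<otimes> x) = \<one>\<^bsub>B\<^esub>"
      using that by (intro ker) simp
    also have "\<dots> \<longleftrightarrow> q x = q y"
      using that q.H.inv_solve_left'[of "\<one>\<^bsub>B\<^esub>" "q y" "q x"] by auto
    finally show ?thesis .
  qed
  let ?X = "subtopology T L" and ?A = "subtopology TA (p ` L)" and ?B = "subtopology TB (q ` L)"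
  have top: "topspace ?X = L" "topspace ?A = p ` L" "topspace ?B = q ` L"
    using compactin_subset_topspace[OF L(2)] openin_subset[OF A(5)] openin_subset[OF B(5)] by auto
  have cpt: "compact_space ?X"
    by (rule compact_space_subtopology[OF L(2)])
  have contp: "continuous_map ?X ?A p" and contq: "continuous_map ?X ?B q"
    using A(4) B(4) by (auto simp: continuous_map_in_subtopology continuous_map_from_subtopology)
  have hd: "Hausdorff_space ?A" "Hausdorff_space ?B"
    using A(2) B(2) by (auto intro: Hausdorff_space_subtopology)
  have "quotient_map ?X ?A p"
    by (rule continuous_imp_quotient_map[OF contp cpt hd(1)]) (simp only: top)
  from quotient_map_lift_exists[OF this contq] obtain f
    where f: "continuous_map ?A ?B f" "f ` topspace ?A = q ` topspace ?X"
      "\<And>x. x \<in> topspace ?X \<Longrightarrow> f (p x) = q x"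
    by (metis eq_iff top(1))
  then have fp: "f (p x) = q x" if "x \<in> L" for x using f(3) that by (simp only: top)
  have inj: "inj_on f (p ` L)"
    using eq_iff by (auto simp: inj_on_def fp)
  have "compact_space ?A"
    using compact_space_subtopology[OF image_compactin[OF L(2) A(4)]] .
  then have "homeomorphic_map ?A ?B f"
    using f inj hd by (intro continuous_imp_homeomorphic_map) (simp_all only: top)
  moreover have "f \<in> iso (A\<lparr>carrier := p ` L\<rparr>) (B\<lparr>carrier := q ` L\<rparr>)"
  proof (rule isoI)
    show "f \<in> hom (A\<lparr>carrier := p ` L\<rparr>) (B\<lparr>carrier := q ` L\<rparr>)"
    proof (rule homI)
      fix a b assume "a \<in> carrier (A\<lparr>carrier := p ` L\<rparr>)" "b \<in> carrier (A\<lparr>carrier := p ` L\<rparr>)"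
      then obtain x y where xy: "x \<in> L" "y \<in> L" "a = p x" "b = p y" by auto
      then have "f (a \<otimes>\<^bsub>A\<^esub> b) = f (p (x \<otimes> y))" by simp
      also have "\<dots> = f a \<otimes>\<^bsub>B\<^esub> f b" using xy fp[of "x \<otimes> y"] by (simp add: fp)
      finally show "f (a \<otimes>\<^bsub>A\<lparr>carrier := p ` L\<rparr>\<^esub> b) = f a \<otimes>\<^bsub>B\<lparr>carrier := q ` L\<rparr>\<^esub> f b"
        by simp
    qed (auto simp: fp)
    show "bij_betw f (carrier (A\<lparr>carrier := p ` L\<rparr>)) (carrier (B\<lparr>carrier := q ` L\<rparr>))"
      using inj f(2)[unfolded top] by (simp add: bij_betw_def)
  qed
  ultimately show ?thesis
    unfolding commensurable_def open_subgroup_def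
    using p.subgroup_img_is_subgroup[OF L(1)] q.subgroup_img_is_subgroup[OF L(1)] A(5) B(5) by blast
qed

text \<open>The image of \<open>H\<close> is an open subgroup of \<open>K\<close>, hence just
  infinite. The image of \<open>M\<close> is normal in it and, being compact, closed.\<close>

lemma image_trivial_or_open:
  assumes K: "hereditarily_just_infinite K U" and p: "p \<in> hom G K" "continuous_map T U p"
    and H: "subgroup H G" "openin U (p ` H)"
    and M: "subgroup M G" "M \<subseteq> H" "compactin T M"
    and normal: "\<And>h m. h \<in> H \<Longrightarrow> m \<in> M \<Longrightarrow> h \<otimes> m \<otimes> inv h \<in> M"
  shows "p ` M = {\<one>\<^bsub>K\<^esub>} \<or> openin U (p ` M)"
proof -
  interpret K: profinite_group K U
    using K by (simp add: hereditarily_just_infinite_def)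
  interpret p: group_hom G K p using p by unfold_locales
  let ?A = "K\<lparr>carrier := p ` H\<rparr>"
  have sub: "subgroup (p ` H) K" "subgroup (p ` M) K"
    using H M by (auto intro: p.subgroup_img_is_subgroup)
  interpret A: group ?A
    by (rule subgroup.subgroup_is_group[OF sub(1)]) (rule K.is_group)
  have ji: "just_infinite ?A (subtopology U (p ` H))"
    using K H sub by (auto simp: hereditarily_just_infinite_def open_subgroup_def)
  have "p ` M \<lhd> ?A"
  proof (subst A.normal_inv_iff, intro conjI ballI)
    show "subgroup (p ` M) ?A"
      using sub M by (intro K.subgroup_incl) auto
    fix a b assume "a \<in> carrier ?A" "b \<in> p ` M"
    then obtain h m where hm: "h \<in> H" "a = p h" "m \<in> M" "b = p m" by auto
    have car: "h \<in> carrier G" "m \<in> carrier G"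
      using hm subgroup.mem_carrier[OF H(1)] subgroup.mem_carrier[OF M(1)] by auto
    have "a \<otimes>\<^bsub>K\<^esub> b \<otimes>\<^bsub>K\<^esub> inv\<^bsub>K\<^esub> a = p (h \<otimes> m \<otimes> inv h)"
      using car hm by simp
    also have "\<dots> \<in> p ` M" using normal hm by blast
    finally show "a \<otimes>\<^bsub>?A\<^esub> b \<otimes>\<^bsub>?A\<^esub> inv\<^bsub>?A\<^esub> a \<in> p ` M"
      using K.m_inv_consistent[OF sub(1), of a] hm by simp
  qed
  moreover have "closedin U (p ` M)"
    by (rule compactin_imp_closedin[OF K.Hausdorff image_compactin[OF M(3) p(2)]])
  then have "closedin (subtopology U (p ` H)) (p ` M)"
    using M(2) by (auto intro: closedin_subset_topspace)
  ultimately have "p ` M \<noteq> {\<one>\<^bsub>K\<^esub>} \<longrightarrow> openin (subtopology U (p ` H)) (p ` M)"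
    using ji by (auto simp: just_infinite_def)
  then show ?thesis
    using H(2) openin_open_subtopology by blast
qed

text \<open>The minimality argument for the openness of \<open>H\<close>, stated for arbitrary
  continuous homomorphisms \<open>p i\<close> in place of coordinate projections. Of
  \<open>H\<close> it uses only compactness and open images.\<close>

lemma openin_coordinate_subgroup:
  fixes K :: "'i \<Rightarrow> ('c, 'd) monoid_scheme" and U :: "'i \<Rightarrow> 'c topology"
  assumes I: "finite I" "i \<in> I"
    and K: "\<And>i. i \<in> I \<Longrightarrow> hereditarily_just_infinite (K i) (U i)"
    and noncomm: "\<And>i j. i \<in> I \<Longrightarrow> j \<in> I \<Longrightarrow> i \<noteq> j \<Longrightarrow> \<not> commensurable (K i) (U i) (K j) (U j)"
    and p: "\<And>i. i \<in> I \<Longrightarrow> p i \<in> hom G (K i)" "\<And>i. i \<in> I \<Longrightarrow> continuous_map T (U i) (p i)"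
    and H: "subgroup H G" "compactin T H" "\<And>i. i \<in> I \<Longrightarrow> openin (U i) (p i ` H)"
  shows "openin (U i) (p i ` {h \<in> H. \<forall>k\<in>I - {i}. p k h = \<one>\<^bsub>K k\<^esub>})"
proof -
  have prof: "profinite_group (K k) (U k)" if "k \<in> I" for k
    using K[OF that] by (simp add: hereditarily_just_infinite_def)
  have grp: "group (K k)" and top: "topspace (U k) = carrier (K k)"
    and hd: "Hausdorff_space (U k)" if "k \<in> I" for k
    using prof[OF that]
    by (auto simp: profinite_group_def profinite_group_axioms_def topological_group_def
        topological_group_axioms_def)
  have ghom: "group_hom G (K k) (p k)" if "k \<in> I" for k
    using grp p that is_group by (simp add: group_hom_def group_hom_axioms_def)
  interpret H: subgroup H G by fact
  \<comment> \<open>\<open>L J\<close> is the subgroup of elements of \<open>H\<close> supported on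
    \<open>J\<close>.\<close>
  define L where "L J = {h \<in> H. \<forall>k\<in>I - J. p k h = \<one>\<^bsub>K k\<^esub>}" for J
  have L_sub: "subgroup (L J) G" for J
  proof (rule subgroupI)
    show "L J \<noteq> {}"
      using group_hom.hom_one[OF ghom] H.one_closed by (auto simp: L_def intro!: exI[of _ \<one>])
  qed (auto simp: L_def group_hom.hom_inv[OF ghom] group_hom.hom_mult[OF ghom]
      group.is_monoid[OF grp] monoid.inv_one)
  have L_cpt: "compactin T (L J)" for J
  proof -
    have "closedin T {h \<in> topspace T. p k h \<in> {\<one>\<^bsub>K k\<^esub>}}" if "k \<in> I" for k
      using that
      by (intro closedin_continuous_map_preimage[OF p(2)] closedin_Hausdorff_singleton[OF hd])
         (auto simp: top group.is_monoid[OF grp])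
    \<comment> \<open>Inserting the whole space keeps the intersected family non-empty when
      \<open>J = I\<close>.\<close>
    then have "closedin T (\<Inter>(insert (topspace T) ((\<lambda>k. {h \<in> topspace T. p k h \<in> {\<one>\<^bsub>K k\<^esub>}}) ` (I - J))))"
      by (intro closedin_Inter) auto
    from compact_Int_closedin[OF H(2) this] show ?thesis
      by (rule back_subst) (use H.subset topspace_eq in \<open>auto simp: L_def\<close>)
  qed
  have L_normal: "h \<otimes> m \<otimes> inv h \<in> L J" if h: "h \<in> H" and m: "m \<in> L J" for h m J
  proof -
    have mH: "m \<in> H" using m by (auto simp: L_def)
    have "p k (h \<otimes> m \<otimes> inv h) = \<one>\<^bsub>K k\<^esub>" if k: "k \<in> I - J" for k
    proof -
      interpret p: group_hom G "K k" "p k" using ghom k by simp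
      show ?thesis using h m mH k by (simp add: L_def)
    qed
    then show ?thesis using h mH by (simp add: L_def)
  qed
  have dich: "p k ` L J = {\<one>\<^bsub>K k\<^esub>} \<or> openin (U k) (p k ` L J)" if "k \<in> I" for k J
    using that L_normal
    by (intro image_trivial_or_open[OF K p H(1) H(3) L_sub _ L_cpt]) (auto simp: L_def)
  \<comment> \<open>Open subgroups of a hereditarily just infinite group are just infinite, and in
    particular infinite.\<close>
  have inf: "infinite (p k ` M)" if "k \<in> I" "subgroup M G" "openin (U k) (p k ` M)" for k M
  proof -
    have "subgroup (p k ` M) (K k)"
      using group_hom.subgroup_img_is_subgroup[OF ghom] that by blast
    then have "just_infinite (K k\<lparr>carrier := p k ` M\<rparr>) (subtopology (U k) (p k ` M))"
      using K[OF that(1)] that(3) by (simp add: hereditarily_just_infinite_def open_subgroup_def)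
    then show ?thesis by (simp add: just_infinite_def)
  qed
  let ?Q = "\<lambda>J. J \<subseteq> I \<and> p i ` L J \<noteq> {\<one>\<^bsub>K i\<^esub>}"
  have "L I = H" by (auto simp: L_def)
  then have "?Q I" using inf[OF I(2) H(1) H(3)[OF I(2)]] by auto
  \<comment> \<open>Least cardinality gives minimality under inclusion, as \<open>J\<close> is
    finite.\<close>
  then obtain J where J: "?Q J" and least: "\<And>J'. ?Q J' \<Longrightarrow> card J \<le> card J'"
    using ex_has_least_nat[of ?Q I card] by auto
  have finJ: "finite J" using J I finite_subset by auto
  have min: "p i ` L J' = {\<one>\<^bsub>K i\<^esub>}" if "J' \<subset> J" for J'
    using least[of J'] psubset_card_mono[OF finJ that] J that by auto
  have triv: "p k ` L J' = {\<one>\<^bsub>K k\<^esub>}" if "\<And>x. x \<in> L J' \<Longrightarrow> p k x = \<one>\<^bsub>K k\<^esub>" for k J'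
    using subgroup.one_closed[OF L_sub[of J']] that by (metis (no_types) image_constant image_cong)
  \<comment> \<open>If \<open>i\<close> were outside \<open>J\<close>, then \<open>p i\<close> would
    vanish on \<open>L J\<close> by definition.\<close>
  have iJ: "i \<in> J" using J triv[of J i] I(2) by (auto simp: L_def)
  have openi: "openin (U i) (p i ` L J)" using dich[OF I(2), of J] J by auto
  have "J = {i}"
  proof (rule ccontr)
    assume "J \<noteq> {i}"
    then obtain j where j: "j \<in> J" "j \<noteq> i" "j \<in> I" using iJ J by auto
    have Lminus: "L (J - {k}) = {x \<in> L J. p k x = \<one>\<^bsub>K k\<^esub>}" if "k \<in> J" for k
      using that J by (auto simp: L_def)
    have ker_le: "p i x = \<one>\<^bsub>K i\<^esub>" if "x \<in> L J" "p j x = \<one>\<^bsub>K j\<^esub>" for x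
      using min[of "J - {j}"] j that Lminus[OF j(1)] by blast
    \<comment> \<open>\<open>L (J - {i})\<close> is the kernel of \<open>p i\<close> on
      \<open>L J\<close>; the dichotomy is applied to its image under \<open>p j\<close>.\<close>
    consider "p j ` L (J - {i}) = {\<one>\<^bsub>K j\<^esub>}" | "openin (U j) (p j ` L (J - {i}))"
      using dich[OF j(3)] by blast
    then show False
    proof cases
      case 1
      \<comment> \<open>Here \<open>p j\<close> kills the kernel of \<open>p i\<close>; together
        with \<open>ker_le\<close> the two kernels on \<open>L J\<close> coincide.\<close>
      then have ker_eq: "p i x = \<one>\<^bsub>K i\<^esub> \<longleftrightarrow> p j x = \<one>\<^bsub>K j\<^esub>" if "x \<in> L J" for x
        using ker_le that Lminus[OF iJ] by blast
      obtain x where x: "x \<in> L J" "p i x \<noteq> \<one>\<^bsub>K i\<^esub>"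
        using J triv[of J i] by blast
      then have "p j ` L J \<noteq> {\<one>\<^bsub>K j\<^esub>}" using ker_eq by blast
      then have "openin (U j) (p j ` L J)" using dich[OF j(3)] by blast
      then have "commensurable (K i) (U i) (K j) (U j)"
        using I(2) j(3) openi ker_eq
        by (intro commensurable_images[OF L_sub L_cpt]) (auto intro: grp hd p)
      then show False using noncomm I(2) j by blast
    next
      case 2
      interpret pi: group_hom G "K i" "p i" by (rule ghom[OF I(2)])
      interpret pj: group_hom G "K j" "p j" by (rule ghom[OF j(3)])
      have car: "x \<in> carrier G" if "x \<in> L J" for x
        using subgroup.mem_carrier[OF L_sub that] .
      \<comment> \<open>If \<open>p j\<close> agrees on \<open>x\<close> and on an element
        \<open>y\<close> killed by \<open>p i\<close>, then \<open>x \<otimes> inv y\<close> is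
        killed by \<open>p j\<close>, hence by \<open>p i\<close>. So the kernel of
        \<open>p i\<close> on \<open>L J\<close> is the full preimage under \<open>p j\<close> of an
        open set.\<close>
      have "p i x = \<one>\<^bsub>K i\<^esub>" if x: "x \<in> L J" and y: "y \<in> L (J - {i})" "p j x = p j y" for x y
      proof -
        have y': "y \<in> L J" "p i y = \<one>\<^bsub>K i\<^esub>" using y Lminus[OF iJ] by auto
        have "x \<otimes> inv y \<in> L J"
          using x y' L_sub by (simp add: subgroup.m_closed subgroup.m_inv_closed)
        moreover have "p j (x \<otimes> inv y) = \<one>\<^bsub>K j\<^esub>"
          using x y y' car by simp
        ultimately have "p i (x \<otimes> inv y) = \<one>\<^bsub>K i\<^esub>" by (rule ker_le)
        then show ?thesis using x y' car by simp
      qed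
      then have "{x \<in> L J. p i x = \<one>\<^bsub>K i\<^esub>} = {x \<in> topspace (subtopology T (L J)). p j x \<in> p j ` L (J - {i})}"
        using Lminus[OF iJ] car by (auto simp: topspace_eq)
      moreover have "openin (subtopology T (L J)) \<dots>"
        by (intro openin_continuous_map_preimage[OF _ 2] continuous_map_from_subtopology p(2) j)
      ultimately have "finite (p i ` L J)"
        by (intro finite_image_open_kernel[OF grp p(1) L_sub L_cpt]) (auto simp: I)
      then show False using inf[OF I(2) L_sub openi] by blast
    qed
  qed
  then show ?thesis using openi by (simp add: L_def)
qed

end

section \<open>The lower rank of a product\<close>

text \<open>Pull an open subgroup \<open>U\<close> of \<open>K\<close> back to \<open>G\<close>.
  Every open subgroup inside the preimage maps onto an open subgroup inside \<open>U\<close> that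
  needs no more generators. For projections this yields the lower bound.\<close>

lemma lower_rank_image_le:
  assumes "topological_group G T" "topological_group K S" "p \<in> hom G K"
    and cont: "continuous_map T S p" and opn: "open_map T S p"
    and surj: "p ` carrier G = carrier K"
  shows "lower_rank K S \<le> lower_rank G T"
  unfolding lower_rank_def
proof (rule SUP_mono)
  interpret G: topological_group G T by fact
  interpret K: topological_group K S by fact
  interpret p: group_hom G K p using assms by unfold_locales
  fix U assume "U \<in> {U. open_subgroup U K S}"
  then have U: "subgroup U K" "openin S U" by (auto simp: open_subgroup_def)
  let ?V = "{x \<in> carrier G. p x \<in> U}"
  have "subgroup ?V G"
    using U(1) by (intro G.subgroupI)
      (auto simp: subgroup.m_closed subgroup.m_inv_closed subgroup.one_closed intro!: exI[of _ "\<one>\<^bsub>G\<^esub>"])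
  moreover have "openin T ?V"
    using openin_continuous_map_preimage[OF cont U(2)] by (simp add: G.topspace_eq)
  ultimately have V: "?V \<in> {U. open_subgroup U G T}" by (simp add: open_subgroup_def)
  have "\<exists>H\<in>{H. open_subgroup H K S \<and> H \<subseteq> U}.
      min_generators (K\<lparr>carrier := H\<rparr>) (subtopology S H)
      \<le> min_generators (G\<lparr>carrier := H'\<rparr>) (subtopology T H')"
    if "H' \<in> {H. open_subgroup H G T \<and> H \<subseteq> ?V}" for H'
  proof (rule bexI[of _ "p ` H'"])
    have H': "subgroup H' G" "openin T H'" using that by (auto simp: open_subgroup_def)
    show "min_generators (K\<lparr>carrier := p ` H'\<rparr>) (subtopology S (p ` H'))
        \<le> min_generators (G\<lparr>carrier := H'\<rparr>) (subtopology T H')"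
      by (rule G.min_generators_image_le) fact+
    show "p ` H' \<in> {H. open_subgroup H K S \<and> H \<subseteq> U}"
      using that H' opn p.subgroup_img_is_subgroup[OF H'(1)]
      by (auto simp: open_subgroup_def open_map_def)
  qed
  then show "\<exists>V\<in>{U. open_subgroup U G T}.
      (INF H\<in>{H. open_subgroup H K S \<and> H \<subseteq> U}. min_generators (K\<lparr>carrier := H\<rparr>) (subtopology S H))
      \<le> (INF H\<in>{H. open_subgroup H G T \<and> H \<subseteq> V}. min_generators (G\<lparr>carrier := H\<rparr>) (subtopology T H))"
    by (intro bexI[OF _ V] INF_mono)
qed

text \<open>The infimum over open subgroups of \<open>U\<close> is attained, as is the number of
  generators. The generators form a family indexed by \<open>k < d\<close>, possibly with
  repetitions, so that families from different factors can be combined coordinatewise.\<close>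

lemma (in topological_group) ex_generated_open_subgroup:
  assumes rank: "lower_rank G T \<le> enat d" and U: "open_subgroup U G T"
  shows "\<exists>H x. open_subgroup H G T \<and> H \<subseteq> U \<and> (\<forall>k<d. x k \<in> H) \<and>
    H \<subseteq> T closure_of (generate G (x ` {..<d}))"
proof -
  let ?\<H> = "{H. open_subgroup H G T \<and> H \<subseteq> U}"
  let ?m = "\<lambda>H. min_generators (G\<lparr>carrier := H\<rparr>) (subtopology T H)"
  have "(INF H\<in>?\<H>. ?m H) \<le> lower_rank G T"
    unfolding lower_rank_def using U by (intro SUP_upper2[of U]) auto
  then have le: "Inf (?m ` ?\<H>) \<le> enat d" using rank by (rule order_trans)
  have "?m ` ?\<H> \<noteq> {}" using U by auto
  then have "Inf (?m ` ?\<H>) \<in> ?m ` ?\<H>"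
    by (rule Inf_enat_in)
  then obtain H where H: "open_subgroup H G T" "H \<subseteq> U" "?m H \<le> enat d"
    using le by auto
  then have sub: "subgroup H G" by (simp add: open_subgroup_def)
  have "?m H < \<infinity>" using H(3) by (cases "?m H") auto
  then obtain X where X: "finite X" "X \<subseteq> H" "H \<subseteq> T closure_of (generate G X)" "card X \<le> d"
    using min_generators_subgroup_attained[OF sub] H(3) by (metis enat_ord_simps(1))
  from X(1) obtain y where y: "bij_betw y {0..<card X} X"
    using ex_bij_betw_nat_finite by blast
  \<comment> \<open>A generating set with fewer than \<open>d\<close> elements is padded with the
    identity.\<close>
  let ?x = "\<lambda>k. if k < card X then y k else \<one>"
  have yX: "y ` {0..<card X} = X" using y by (simp add: bij_betw_def)
  have mem: "?x k \<in> H" for k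
    using yX X(2) subgroup.one_closed[OF sub] by force
  have "X \<subseteq> ?x ` {..<d}"
  proof
    fix a assume "a \<in> X"
    then obtain k where "k < card X" "a = y k" using yX by force
    then show "a \<in> ?x ` {..<d}" using X(4) by (intro image_eqI[of _ _ k]) auto
  qed
  then have "T closure_of (generate G X) \<subseteq> T closure_of (generate G (?x ` {..<d}))"
    by (intro closure_of_mono mono_generate)
  with X(3) have "H \<subseteq> T closure_of (generate G (?x ` {..<d}))" by (rule subset_trans)
  with H mem show ?thesis by (intro exI[of _ H] exI[of _ ?x] conjI allI impI)
qed

text \<open>Every open \<open>U\<close> is shown to contain an open subgroup with at most
  \<open>d\<close> topological generators, which bounds each infimum in the definition of the lower
  rank.\<close>

lemma lower_rank_product_le:
  fixes G :: "'i \<Rightarrow> ('a, 'b) monoid_scheme" and T :: "'i \<Rightarrow> 'a topology"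
  assumes I: "finite I"
    and hji: "\<And>i. i \<in> I \<Longrightarrow> hereditarily_just_infinite (G i) (T i)"
    and noncomm: "\<And>i j. i \<in> I \<Longrightarrow> j \<in> I \<Longrightarrow> i \<noteq> j \<Longrightarrow> \<not> commensurable (G i) (T i) (G j) (T j)"
    and rank: "\<And>i. i \<in> I \<Longrightarrow> lower_rank (G i) (T i) \<le> enat d"
  shows "lower_rank (product_group I G) (product_topology T I) \<le> enat d"
proof -
  let ?P = "product_group I G" and ?S = "product_topology T I"
  let ?e = "\<lambda>i x. \<lambda>k\<in>I. if k = i then x else \<one>\<^bsub>G k\<^esub>"
  have prof: "profinite_group (G i) (T i)" if "i \<in> I" for i
    using hji[OF that] by (simp add: hereditarily_just_infinite_def)
  have tg: "topological_group (G i) (T i)" if "i \<in> I" for i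
    using prof[OF that] by (simp add: profinite_group_def)
  have grp: "group (G i)" if "i \<in> I" for i
    using tg[OF that] by (simp add: topological_group_def)
  interpret P: topological_group ?P ?S by (rule topological_group_product) (rule tg)
  have cpt: "compact_space ?S"
    using prof by (auto simp: compact_space_product_topology profinite_group_def profinite_group_axioms_def)
  have "(INF H\<in>{H. open_subgroup H ?P ?S \<and> H \<subseteq> U}. min_generators (?P\<lparr>carrier := H\<rparr>) (subtopology ?S H))
      \<le> enat d" if U: "open_subgroup U ?P ?S" for U
  proof -
    have U': "subgroup U ?P" "openin ?S U" using U by (auto simp: open_subgroup_def)
    define R where "R i H x \<longleftrightarrow> open_subgroup H (G i) (T i) \<and> H \<subseteq> {a \<in> carrier (G i). ?e i a \<in> U} \<and>
        (\<forall>k<d. x k \<in> H) \<and> H \<subseteq> T i closure_of (generate (G i) (x ` {..<d}))"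
      for i H and x :: "nat \<Rightarrow> 'a"
    have "\<exists>H x. R i H x" if i: "i \<in> I" for i
    proof -
      interpret Gi: topological_group "G i" "T i" by (rule tg[OF i])
      interpret e: group_hom "G i" ?P "?e i"
        using product_embedding_hom[OF i grp] by unfold_locales
      let ?V = "{a \<in> carrier (G i). ?e i a \<in> U}"
      have "subgroup ?V (G i)"
      proof (rule Gi.subgroupI)
        show "?V \<noteq> {}"
          using e.hom_one subgroup.one_closed[OF U'(1)] Gi.one_closed by force
        fix a b assume a: "a \<in> ?V" and b: "b \<in> ?V"
        show "inv\<^bsub>G i\<^esub> a \<in> ?V"
          using a e.hom_inv[of a] subgroup.m_inv_closed[OF U'(1)] by auto
        show "a \<otimes>\<^bsub>G i\<^esub> b \<in> ?V"
          using a b e.hom_mult[of a b] subgroup.m_closed[OF U'(1), of "?e i a" "?e i b"]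
          by (auto simp del: mult_product_group)
      qed auto
      moreover have "openin (T i) ?V"
        using openin_continuous_map_preimage[OF product_embedding_continuous[OF i tg] U'(2)]
        by (simp add: Gi.topspace_eq)
      ultimately have "open_subgroup ?V (G i) (T i)"
        by (simp add: open_subgroup_def)
      then show ?thesis
        unfolding R_def by (rule Gi.ex_generated_open_subgroup[OF rank[OF i]])
    qed
    then obtain H x where Hx: "\<And>i. i \<in> I \<Longrightarrow> R i (H i) (x i)"
      by metis
    have H: "open_subgroup (H i) (G i) (T i)" "H i \<subseteq> {a \<in> carrier (G i). ?e i a \<in> U}"
      and x: "\<And>k. k < d \<Longrightarrow> x i k \<in> H i" "H i \<subseteq> T i closure_of (generate (G i) (x i ` {..<d}))"
      if "i \<in> I" for i
      using Hx[OF that] by (simp_all only: R_def)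
    have Hsub: "subgroup (H i) (G i)" and Hopen: "openin (T i) (H i)" if "i \<in> I" for i
      using H(1)[OF that] by (auto simp: open_subgroup_def)
    \<comment> \<open>The \<open>k\<close>-th element takes the \<open>k\<close>-th generator in
      every coordinate at once, so \<open>d\<close> elements serve all factors together.\<close>
    let ?y = "\<lambda>k. \<lambda>i\<in>I. x i k"
    let ?Y = "?y ` {..<d}"
    let ?K = "?S closure_of (generate ?P ?Y)"
    have Y: "?Y \<subseteq> Pi\<^sub>E I H" using x(1) by auto
    have PH: "subgroup (Pi\<^sub>E I H) ?P"
      using grp Hsub by (simp add: PiE_subgroup_product_group)
    have YP: "?Y \<subseteq> carrier ?P" using Y subgroup.subset[OF PH] by (rule subset_trans)
    have K: "subgroup ?K ?P"
      by (intro P.subgroup_closure P.generate_is_subgroup YP)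
    have "generate ?P ?Y \<subseteq> ?K"
      by (rule closure_of_subset, subst P.topspace_eq, rule P.generate_incl[OF YP])
    then have YK: "?Y \<subseteq> ?K"
      using generate.incl[of _ ?Y ?P] by (meson subset_iff)
    have "closedin ?S (Pi\<^sub>E I H)"
      using topological_group.closedin_open_subgroup[OF tg Hsub Hopen]
      by (simp add: closedin_product_topology)
    then have KH: "?K \<subseteq> Pi\<^sub>E I H"
      by (intro closure_of_minimal P.generate_subgroup_incl[OF Y PH])
    have "Pi\<^sub>E I H \<subseteq> U"
      using H(2) grp by (intro PiE_subset_subgroup[OF I _ U'(1)]) auto
    with KH have KU: "?K \<subseteq> U" by simp
    have Kcpt: "compactin ?S ?K"
      by (intro closedin_compact_space[OF cpt] closedin_closure_of)
    have proj: "openin (T i) ((\<lambda>z. z i) ` ?K)" if i: "i \<in> I" for i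
    proof -
      interpret Gi: profinite_group "G i" "T i" by (rule prof[OF i])
      interpret p: group_hom ?P "G i" "\<lambda>z. z i"
        using product_projection_hom[OF i] by unfold_locales
      have "closedin (T i) ((\<lambda>z. z i) ` ?K)"
        by (intro compactin_imp_closedin[OF Gi.Hausdorff]
            image_compactin[OF Kcpt continuous_map_product_projection[OF i]])
      moreover have "generate (G i) (x i ` {..<d}) \<subseteq> (\<lambda>z. z i) ` ?K"
      proof (rule Gi.generate_subgroup_incl)
        have "x i k \<in> (\<lambda>z. z i) ` ?K" if "k < d" for k
          using YK that i by (intro image_eqI[of _ _ "?y k"]) auto
        then show "x i ` {..<d} \<subseteq> (\<lambda>z. z i) ` ?K" by auto
      qed (rule p.subgroup_img_is_subgroup[OF K])
      \<comment> \<open>The projection is a closed subgroup containing the generators of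
        \<open>H i\<close>, so it contains the open set \<open>H i\<close>.\<close>
      ultimately have "H i \<subseteq> (\<lambda>z. z i) ` ?K"
        by (intro subset_trans[OF x(2)[OF i]] closure_of_minimal)
      then show ?thesis
        using Gi.openin_subgroupI[OF p.subgroup_img_is_subgroup[OF K] Hopen[OF i]]
          subgroup.one_closed[OF Hsub[OF i]] by auto
    qed
    \<comment> \<open>\<open>?N i\<close> is the intersection of \<open>?K\<close> with the
      \<open>i\<close>-th factor, read in that factor.\<close>
    let ?N = "\<lambda>i. (\<lambda>z. z i) ` {h \<in> ?K. \<forall>k\<in>I - {i}. h k = \<one>\<^bsub>G k\<^esub>}"
    have Kcar: "?K \<subseteq> carrier ?P" using subgroup.subset[OF K] .
    have N: "openin (T i) (?N i)" if "i \<in> I" for i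
      using P.openin_coordinate_subgroup[OF I that hji noncomm product_projection_hom
          continuous_map_product_projection K Kcpt proj] .
    have NK: "Pi\<^sub>E I ?N \<subseteq> ?K"
    proof (rule PiE_subset_subgroup[OF I grp K])
      fix i a assume i: "i \<in> I" and "a \<in> ?N i"
      then obtain h where h: "h \<in> ?K" "\<And>k. k \<in> I \<Longrightarrow> k \<noteq> i \<Longrightarrow> h k = \<one>\<^bsub>G k\<^esub>" "a = h i" by auto
      have hP: "h \<in> (\<Pi>\<^sub>E i\<in>I. carrier (G i))" using h(1) Kcar by auto
      have "?e i a = h"
        using h i hP by (intro extensionalityI[of _ I]) (auto simp: PiE_iff)
      then show "a \<in> carrier (G i) \<and> ?e i a \<in> ?K" using h i hP by auto
    qed auto
    \<comment> \<open>A finite product of open sets is open, so \<open>?K\<close> contains a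
      non-empty open set.\<close>
    have "openin ?S (Pi\<^sub>E I ?N)"
      by (simp add: openin_PiE I N)
    moreover have "(\<lambda>i\<in>I. \<one>\<^bsub>G i\<^esub>) \<in> Pi\<^sub>E I ?N"
      using subgroup.one_closed[OF K] by (auto intro!: image_eqI[of _ _ "\<lambda>i\<in>I. \<one>\<^bsub>G i\<^esub>"])
    ultimately have "openin ?S ?K"
      using P.openin_subgroupI[OF K _ NK] by blast
    then have "?K \<in> {H. open_subgroup H ?P ?S \<and> H \<subseteq> U}"
      using K KU by (simp add: open_subgroup_def)
    moreover have "min_generators (?P\<lparr>carrier := ?K\<rparr>) (subtopology ?S ?K) \<le> enat (card ?Y)"
      by (rule P.min_generators_subgroup_le[OF K _ YK]) auto
    then have "min_generators (?P\<lparr>carrier := ?K\<rparr>) (subtopology ?S ?K) \<le> enat d"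
      \<comment> \<open>Combined generators may coincide, so only an upper bound on their number is
        available.\<close>
      using card_image_le[of "{..<d}" ?y] by (simp add: order_trans)
    ultimately show ?thesis by (rule INF_lower2)
  qed
  then show ?thesis
    unfolding lower_rank_def by (auto intro: SUP_least)
qed

theorem corollary2:
  fixes n :: nat
    and G :: "nat \<Rightarrow> ('a, 'b) monoid_scheme"
    and T :: "nat \<Rightarrow> 'a topology"
  assumes "n \<ge> 1"
    and "\<And>i. i \<in> {1..n} \<Longrightarrow> profinite_group (G i) (T i)"
    and "\<And>i. i \<in> {1..n} \<Longrightarrow> hereditarily_just_infinite (G i) (T i)"
    and "\<And>i j. i \<in> {1..n} \<Longrightarrow> j \<in> {1..n} \<Longrightarrow> i \<noteq> j \<Longrightarrow> \<not> commensurable (G i) (T i) (G j) (T j)"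
    and "\<And>i. i \<in> {1..n} \<Longrightarrow> lower_rank (G i) (T i) < \<infinity>"
  shows "lower_rank (product_group {1..n} G) (product_topology T {1..n}) =
           (MAX i \<in> {1..n}. lower_rank (G i) (T i))"
proof (rule antisym)
  let ?P = "product_group {1..n} G" and ?S = "product_topology T {1..n}"
  let ?M = "MAX i \<in> {1..n}. lower_rank (G i) (T i)"
  have tg: "topological_group (G i) (T i)" if "i \<in> {1..n}" for i
    using assms(2)[OF that] by (simp add: profinite_group_def)
  interpret P: topological_group ?P ?S by (rule topological_group_product) (rule tg)
  have ne: "{1..n} \<noteq> {}" using assms(1) by simp
  \<comment> \<open>The maximum is one of the finite lower ranks, hence a natural number
    \<open>d\<close>.\<close>
  have "?M \<in> (\<lambda>i. lower_rank (G i) (T i)) ` {1..n}"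
    using ne by (intro Max_in) auto
  then have "?M < \<infinity>" using assms(5) by auto
  then obtain d where d: "?M = enat d" by (cases ?M) auto
  have "lower_rank (G i) (T i) \<le> enat d" if "i \<in> {1..n}" for i
    unfolding d[symmetric] using that by (intro Max_ge) auto
  then show "lower_rank ?P ?S \<le> ?M"
    unfolding d by (intro lower_rank_product_le assms(3,4)) auto
  \<comment> \<open>The projection onto a factor is continuous, open and surjective, so the lower
    rank cannot increase.\<close>
  have "lower_rank (G i) (T i) \<le> lower_rank ?P ?S" if i: "i \<in> {1..n}" for i
  proof (rule lower_rank_image_le[OF P.topological_group_axioms tg[OF i] product_projection_hom[OF i]])
    interpret Gi: topological_group "G i" "T i" by (rule tg[OF i])
    show "(\<lambda>x. x i) ` carrier ?P = carrier (G i)"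
    proof (intro equalityI subsetI)
      fix a assume "a \<in> carrier (G i)"
      then have "(\<lambda>k\<in>{1..n}. if k = i then a else \<one>\<^bsub>G k\<^esub>) \<in> carrier ?P"
        using product_embedding_hom[OF i, of G] tg by (auto simp: hom_def topological_group_def Pi_iff)
      then show "a \<in> (\<lambda>x. x i) ` carrier ?P" by (rule rev_image_eqI) (use i in simp)
    qed (use i in auto)
  qed (use i in \<open>auto intro: continuous_map_product_projection open_map_product_projection\<close>)
  then show "?M \<le> lower_rank ?P ?S"
    using ne by (intro Max.boundedI) auto
qed

end
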